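(* Let $a \in \mathbf{F}_q$ be nonzero and let $n\ge 1$. Let $f(x) \in \mathbf{F}_q[x]$ be a nontrivial $a$-self reciprocal monic polynomial of degree $2n$ that is a product of $r$ pairwise distinct monic irreducible polynomials over $\mathbf{F}_q$. Then $r \equiv 0 \pmod 2$ if and only if $$(-1)^n a^{n(n-2)} f(\sqrt{a})\, f(-\sqrt{a})$$ is a square in $\mathbf{F}_q$, where $\sqrt{a}$ is a square root of $a$ in an extension of $\mathbf{F}_q$.
   Context: Let $q=p^e$ be an odd prime power and $\mathbf{F}_q$ the finite field with $q$ elements. For a nonzero $a\in\mathbf{F}_q$ and a monic polynomial $f(x)=\sum_{i=0}^N b_i x^i \in \mathbf{F}_q[x]$ of degree $N$ with $f(0)\neq 0$, the $a$-reciprocal of $f$ is $\hat{f}_a(x) := \frac{x^N}{f(0)} f\left(\frac{a}{x}\right) = \frac{1}{b_0}\sum_{i=0}^N b_i a^i x^{N-i}$. A monic polynomial $f(x)$ (with $f(0)\ne 0$) is $a$-self reciprocal if $\hat{f}_a(x)=f(x)$. An $a$-self reciprocal monic polynomial of even degree $N=2m$ is called nontrivial if its constant term is $b_0=a^m$. The product $f(\sqrt{a})f(-\sqrt{a})$ always lies in $\mathbf{F}_q$. The exponent $n(n-2)$ may be negative (when $n=1$), in which case the power is taken in the multiplicative group of $\mathbf{F}_q$. *)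

theory Defs
  imports
    "HOL-Library.Cardinality"
    "HOL-Computational_Algebra.Computational_Algebra"
    "Jordan_Normal_Form.Ring_Hom_Matrix"
begin

definition a_reciprocal :: "'a::field \<Rightarrow> 'a poly \<Rightarrow> 'a poly" where
  "a_reciprocal a f =
    Polynomial.smult (1 / coeff f 0) (\<Sum>i\<le>degree f. monom (coeff f i * a ^ i) (degree f - i))"

lemma poly_a_reciprocal:
  fixes a x :: "'a::field"
  assumes "x \<noteq> 0"
  shows "poly (a_reciprocal a f) x = x ^ degree f / poly f 0 * poly f (a / x)"
proof -
  have "(\<Sum>i\<le>degree f. coeff f i * a ^ i * x ^ (degree f - i))
      = (\<Sum>i\<le>degree f. x ^ degree f * (coeff f i * (a / x) ^ i))"
    using assms by (intro sum.cong) (auto simp: power_diff field_simps)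
  also have "\<dots> = x ^ degree f * poly f (a / x)"
    by (simp add: poly_altdef sum_distrib_left)
  finally show ?thesis
    by (simp add: a_reciprocal_def poly_sum poly_monom poly_0_coeff_0)
qed

definition self_reciprocal :: "'a::field \<Rightarrow> 'a poly \<Rightarrow> bool" where
  "self_reciprocal a f \<longleftrightarrow> lead_coeff f = 1 \<and> coeff f 0 \<noteq> 0 \<and> a_reciprocal a f = f"

definition nontrivial_self_reciprocal :: "'a::field \<Rightarrow> 'a poly \<Rightarrow> bool" where
  "nontrivial_self_reciprocal a f \<longleftrightarrow>
     self_reciprocal a f \<and> (\<exists>m. degree f = 2 * m \<and> coeff f 0 = a ^ m)"

end

theory Submission
  imports Defs "Jordan_Normal_Form.Char_Poly" "HOL-Number_Theory.Residues"
    "HOL-Algebra.Algebraic_Closure_Type"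
begin

text \<open>
  Work in the algebraic closure of \<open>F\<^sub>q\<close> with the Frobenius map \<open>frob x = x^q\<close>. Monic irreducible
  polynomials are the products of \<open>X - y\<close> over Frobenius orbits, and \<open>x \<mapsto> a/x\<close> permutes the roots
  of \<open>f\<close> without fixed points: a fixed point would be a double root. A factor \<open>p\<close> of degree \<open>2m\<close>
  that is invariant under this involution satisfies \<open>(-a)^m p(s) p(-s) = D\<^sup>2\<close> with \<open>frob D = -D\<close>,
  where \<open>s\<close> is a square root of \<open>a\<close>; for a product of two distinct factors that are exchanged, the
  analogous \<open>D\<close> lies in \<open>F\<^sub>q\<close>. Multiplying, \<open>(-a)^n f(s) f(-s)\<close> has a square root on
  which Frobenius acts by \<open>(-1)^r\<close>, so it is a square in \<open>F\<^sub>q\<close> iff \<open>r\<close> is even. Finally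
  \<open>(-1)^n a^(n(n-2))\<close> differs from \<open>(-a)^n\<close> by the square \<open>a^(n(n-3))\<close>.
\<close>

hide_const (open) Polynomials.degree Polynomials.lead_coeff Divisibility.irreducible up_ring.monom up_ring.coeff

subsection \<open>The Frobenius map on the algebraic closure\<close>

interpretation to_ac: field_hom to_ac
  by unfold_locales auto

interpretation to_ac_poly: map_poly_inj_idom_hom to_ac ..

definition frob :: "'a::finite_field alg_closure \<Rightarrow> 'a alg_closure" where
  "frob x = x ^ CARD('a)"

lemma frob_to_ac [simp]: "frob (to_ac c) = to_ac c"
  by (simp add: frob_def finite_field_power_card_eq_same flip: to_ac_power)

text \<open>
  Additivity of Frobenius without knowing that \<open>q\<close> is a prime power: the polynomial
  \<open>(X + 1)^q - X^q - 1\<close> has degree less than \<open>q\<close> but vanishes on all of \<open>F\<^sub>q\<close>.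
\<close>

lemma X_plus_1_power_card:
  "[:1, 1:] ^ CARD('a) = monom 1 (CARD('a)) + (1 :: 'a::finite_field poly)"
proof -
  let ?q = "CARD('a)" and ?d = "[:1, 1:] ^ CARD('a) - monom (1::'a) (CARD('a))"
  have q: "?q > 0" by (simp add: finite_UNIV_card_ge_0)
  have deg: "degree ([:1, 1:] ^ ?q :: 'a poly) = ?q"
    by (simp add: degree_power_eq)
  have "coeff ([:1, 1:] ^ ?q :: 'a poly) ?q = 1"
    using lead_coeff_power[of "[:1, 1::'a:]" ?q] by (simp add: deg)
  then have "coeff ?d ?q = 0" by simp
  moreover have "degree ?d \<le> ?q"
    by (rule degree_diff_le) (auto simp: deg degree_monom_le)
  ultimately have "degree ?d < ?q"
    using q by (metis degree_0 le_neq_implies_less leading_coeff_0_iff)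
  then have "?d = 1"
    using q by (intro poly_eqI_degree[of UNIV])
      (auto simp: poly_monom finite_field_power_card_eq_same)
  then show ?thesis by (simp add: diff_eq_eq)
qed

lemma frob_mult: "frob (x * y) = frob x * frob y"
  by (simp add: frob_def power_mult_distrib)

lemma frob_0: "frob 0 = 0"
  using frob_to_ac[of 0] by simp

lemma frob_1: "frob 1 = 1"
  by (simp add: frob_def)

lemma frob_add_1: "frob (x + 1) = frob x + 1"
  for x :: "'a::finite_field alg_closure"
proof -
  have "[:1, 1:] ^ CARD('a) = map_poly to_ac ([:1, 1:] ^ CARD('a) :: 'a poly)"
    by (simp add: to_ac_poly.hom_power)
  also have "\<dots> = monom (1::'a alg_closure) CARD('a) + 1"
    by (simp add: X_plus_1_power_card hom_distribs)
  finally have "poly ([:1, 1:] ^ CARD('a)) x = poly (monom 1 CARD('a) + 1) x" by simp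
  then show ?thesis by (simp add: frob_def poly_monom add.commute)
qed

text \<open>Homogenising: for nonzero \<open>y\<close>, division by \<open>y\<close> reduces the
  claim to the case \<open>y = 1\<close>, since Frobenius is multiplicative.\<close>

lemma frob_add: "frob (x + y) = frob x + frob y"
proof (cases "y = 0")
  case False
  then have "x + y = y * (x / y + 1)" by (simp add: field_simps)
  then have "frob (x + y) = frob y * frob (x / y) + frob y"
    by (simp only: frob_mult frob_add_1) (simp add: distrib_left)
  also have "frob y * frob (x / y) = frob x"
    using False by (simp flip: frob_mult)
  finally show ?thesis .
qed (simp add: frob_0)

interpretation frob: field_hom frob
  by unfold_locales (simp_all add: frob_0 frob_1 frob_add frob_mult)

interpretation frob_poly: map_poly_inj_idom_hom frob ..

text \<open>The fixed points are the roots of X^q - X, so there are at most q of them, and the base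
  field already supplies q.\<close>

lemma frob_eq_self_iff: "frob x = x \<longleftrightarrow> x \<in> range to_ac"
  for x :: "'a::finite_field alg_closure"
proof
  assume x: "frob x = x"
  let ?p = "monom 1 CARD('a) + [:0, - 1:] :: 'a alg_closure poly"
  have "CARD('a) \<ge> 2" using card_2_iff' card_mono[of UNIV "{0, 1::'a}"] by auto
  then have deg: "degree ?p = CARD('a)"
    by (simp add: degree_add_eq_left degree_monom_eq degree_pCons_eq_if)
  then have nz: "?p \<noteq> 0" using \<open>CARD('a) \<ge> 2\<close> by auto
  have roots: "{x. poly ?p x = 0} = {x. frob x = x}"
    by (simp add: frob_def poly_monom)
  have "range to_ac \<subseteq> {x::'a alg_closure. frob x = x}" by auto
  moreover have "card {x::'a alg_closure. frob x = x} \<le> card (range (to_ac :: 'a \<Rightarrow> _))"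
    using card_poly_roots_bound[OF nz] unfolding roots deg by (simp add: card_image inj_to_ac)
  moreover have "finite {x::'a alg_closure. frob x = x}"
    using poly_roots_finite[OF nz] unfolding roots .
  ultimately have "range to_ac = {x::'a alg_closure. frob x = x}"
    by (intro card_seteq)
  then show "x \<in> range to_ac" using x by auto
qed auto

lemma poly_map_to_ac_frob:
  "poly (map_poly to_ac p) (frob x) = frob (poly (map_poly to_ac p) x)"
  by (induction p) (simp_all add: map_poly_pCons frob.hom_add frob.hom_mult)

subsection \<open>Irreducible polynomials as products over Frobenius orbits\<close>

definition orbit :: "'a::finite_field alg_closure \<Rightarrow> 'a alg_closure set" where
  "orbit x = range (\<lambda>i. (frob ^^ i) x)"

definition orbit_poly :: "'a::finite_field alg_closure \<Rightarrow> 'a alg_closure poly" where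
  "orbit_poly x = (\<Prod>y\<in>orbit x. [:- y, 1:])"

lemma self_in_orbit [simp]: "x \<in> orbit x"
  unfolding orbit_def by (rule range_eqI[of _ _ 0]) simp

lemma funpow_frob_in_orbit [simp]: "(frob ^^ i) x \<in> orbit x"
  by (simp add: orbit_def)

lemma poly_root_orbit:
  assumes "poly (map_poly to_ac p) x = 0" "y \<in> orbit x"
  shows "poly (map_poly to_ac p) y = 0"
proof -
  have "poly (map_poly to_ac p) ((frob ^^ i) x) = 0" for i
    by (induction i) (simp_all add: assms(1) poly_map_to_ac_frob)
  then show ?thesis using assms(2) by (auto simp: orbit_def)
qed

lemma degree_map_poly_to_ac [simp]: "degree (map_poly to_ac p) = degree p"
  by (intro degree_map_poly) auto

text \<open>All conjugates of \<open>x\<close> are roots of one nonzero polynomial over the base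
  field.\<close>

lemma finite_orbit [simp]: "finite (orbit x)"
proof -
  obtain p where "p \<noteq> 0" "poly (map_poly to_ac p) x = 0"
    by (rule alg_closure_algebraic)
  then have nz: "p \<noteq> 0" and sub: "orbit x \<subseteq> {y. poly (map_poly to_ac p) y = 0}"
    using poly_root_orbit by blast+
  then show ?thesis
    by (intro finite_subset[OF sub] poly_roots_finite) simp
qed

lemma frob_image_orbit: "frob ` orbit x = orbit x"
proof (rule endo_inj_surj)
  show "frob ` orbit x \<subseteq> orbit x"
  proof
    fix y assume "y \<in> frob ` orbit x"
    then obtain i where "y = (frob ^^ Suc i) x" by (auto simp: orbit_def)
    then show "y \<in> orbit x" by (simp only: funpow_frob_in_orbit)
  qed
qed (auto intro: inj_onI)

lemma degree_orbit_poly: "degree (orbit_poly x) = card (orbit x)"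
  by (simp add: orbit_poly_def degree_prod_eq_sum_degree)

lemma lead_coeff_orbit_poly: "lead_coeff (orbit_poly x) = 1"
  by (simp add: orbit_poly_def lead_coeff_prod)

lemma poly_orbit_poly: "poly (orbit_poly x) t = (\<Prod>y\<in>orbit x. t - y)"
  by (simp add: orbit_poly_def poly_prod)

text \<open>Frobenius permutes the linear factors, so it fixes every coefficient, and its fixed
  points are the base field.\<close>

lemma orbit_poly_over_base: "\<exists>g. map_poly to_ac g = orbit_poly x"
proof -
  have "map_poly frob (orbit_poly x) = (\<Prod>y\<in>orbit x. [:- frob y, 1:])"
    unfolding orbit_poly_def by (simp add: frob_poly.hom_prod hom_distribs)
  also have "\<dots> = (\<Prod>y\<in>frob ` orbit x. [:- y, 1:])"
    by (subst prod.reindex) (auto intro: inj_onI)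
  finally have "map_poly frob (orbit_poly x) = orbit_poly x"
    by (simp add: frob_image_orbit orbit_poly_def)
  then have "frob (coeff (orbit_poly x) i) = coeff (orbit_poly x) i" for i
    by (metis coeff_map_poly frob.hom_zero)
  then have "to_ac (of_ac (coeff (orbit_poly x) i)) = coeff (orbit_poly x) i" for i
    by (simp add: to_ac_of_ac frob_eq_self_iff)
  then have "map_poly to_ac (map_poly of_ac (orbit_poly x)) = orbit_poly x"
    by (simp add: poly_eq_iff coeff_map_poly)
  then show ?thesis by blast
qed

text \<open>The orbit polynomial descends to some \<open>g\<close> over the base field. The
  remainder \<open>p mod g\<close> has more zeros than its degree allows, so \<open>g\<close>
  divides \<open>p\<close>, and irreducibility forces equality.\<close>

lemma irreducible_eq_orbit_poly:
  fixes p :: "'a::finite_field poly"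
  assumes "irreducible p" "lead_coeff p = 1" "poly (map_poly to_ac p) x = 0"
  shows "map_poly to_ac p = orbit_poly x"
proof -
  obtain g :: "'a poly" where g: "map_poly to_ac g = orbit_poly x"
    using orbit_poly_over_base by blast
  have deg_g: "degree g = card (orbit x)"
    using arg_cong[OF g, of degree] by (simp add: degree_orbit_poly)
  have monic_g: "lead_coeff g = 1"
    using arg_cong[OF g, of lead_coeff] by (simp add: lead_coeff_orbit_poly coeff_map_poly)
  have "card (orbit x) > 0"
    using self_in_orbit[of x] by (auto simp: card_gt_0_iff simp del: self_in_orbit)
  have "poly (map_poly to_ac (p mod g)) y = 0" if "y \<in> orbit x" for y
  proof -
    have "p mod g = p - g * (p div g)" by (simp add: minus_mult_div_eq_mod)
    moreover have "poly (orbit_poly x) y = 0"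
      using that by (auto simp: poly_orbit_poly)
    ultimately show ?thesis
      using poly_root_orbit[OF assms(3) that] by (simp add: hom_distribs g)
  qed
  moreover have "degree (p mod g) < card (orbit x)"
    using degree_mod_less'[of g p] deg_g \<open>card (orbit x) > 0\<close>
    by (cases "g = 0"; cases "p mod g = 0") auto
  ultimately have "map_poly to_ac (p mod g) = 0"
    by (intro poly_eqI_degree[of "orbit x"]) auto
  then have "g dvd p" by (simp add: dvd_eq_mod_eq_0)
  moreover have "\<not> is_unit g"
    using deg_g \<open>card (orbit x) > 0\<close> by (auto simp: is_unit_iff_degree)
  ultimately have "p dvd g"
    using assms(1) irreducibleD' by blast
  with \<open>g dvd p\<close> assms(2) monic_g have "p = g"
    by (intro poly_dvd_antisym) auto
  then show ?thesis using g by simp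
qed

lemma irreducible_roots_eq_orbit:
  assumes "irreducible p" "lead_coeff p = 1" "poly (map_poly to_ac p) x = 0"
  shows "poly (map_poly to_ac p) y = 0 \<longleftrightarrow> y \<in> orbit x"
  using irreducible_eq_orbit_poly[OF assms] by (auto simp: poly_orbit_poly)

lemma irreducible_common_root_eq:
  fixes p p' :: "'a::finite_field poly"
  assumes "irreducible p" "lead_coeff p = 1" "poly (map_poly to_ac p) x = 0"
    and "irreducible p'" "lead_coeff p' = 1" "poly (map_poly to_ac p') x = 0"
  shows "p = p'"
  using irreducible_eq_orbit_poly[OF assms(1-3)] irreducible_eq_orbit_poly[OF assms(4-6)]
  by (metis to_ac_poly.eq_iff)

lemma irreducible_root_exists:
  fixes p :: "'a::finite_field poly"
  assumes "irreducible p"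
  shows "\<exists>x. poly (map_poly to_ac p) x = 0"
proof -
  have "degree p > 0"
    using assms by (auto simp: irreducible_def is_unit_iff_degree intro!: Nat.gr0I)
  then show ?thesis
    by (intro alg_closed_imp_poly_has_root) auto
qed

subsection \<open>The norm of the value at a square root\<close>

text \<open>The norm of the class of \<open>f\<close> in F[X]/(X^2 - a). Computed from a remainder,
  it involves neither an extension nor a choice of root, so values in different extensions can be
  compared.\<close>

definition sqrt_norm :: "'a::field \<Rightarrow> 'a poly \<Rightarrow> 'a" where
  "sqrt_norm a f = (let r = f mod [:- a, 0, 1:] in (coeff r 0)\<^sup>2 - a * (coeff r 1)\<^sup>2)"

text \<open>Both \<open>s\<close> and \<open>- s\<close> are zeros of X^2 - a, so only the linear
  remainder r0 + r1 X matters, and the product is r0^2 - a r1^2.\<close>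

lemma hom_sqrt_norm:
  assumes "field_hom \<iota>" "s ^ 2 = \<iota> a"
  shows "poly (map_poly \<iota> f) s * poly (map_poly \<iota> f) (- s) = \<iota> (sqrt_norm a f)"
proof -
  interpret field_hom \<iota> by fact
  interpret poly: map_poly_inj_idom_hom \<iota> ..
  define g r where "g = [:- a, 0, 1:]" and "r = f mod g"
  have "degree r < 2"
    using degree_mod_less[of g f] by (auto simp: g_def r_def)
  then have r: "r = [:coeff r 0, coeff r 1:]"
    by (auto simp: poly_eq_iff coeff_pCons coeff_eq_0 split: nat.split)
  have val: "poly (map_poly \<iota> f) t = \<iota> (coeff r 0) + \<iota> (coeff r 1) * t"
    if "t ^ 2 = \<iota> a" for t
  proof -
    have "f = g * (f div g) + r" by (simp add: r_def)
    then have "map_poly \<iota> f = map_poly \<iota> g * map_poly \<iota> (f div g) + map_poly \<iota> [:coeff r 0, coeff r 1:]"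
      by (metis poly.hom_add poly.hom_mult r)
    then have "poly (map_poly \<iota> f) t = poly (map_poly \<iota> g) t * poly (map_poly \<iota> (f div g)) t
        + poly (map_poly \<iota> [:coeff r 0, coeff r 1:]) t"
      by (metis poly_add poly_mult)
    moreover have "poly (map_poly \<iota> g) t = 0"
      using that by (simp add: g_def hom_distribs power2_eq_square)
    ultimately show ?thesis by (simp add: hom_distribs mult.commute)
  qed
  have "poly (map_poly \<iota> f) s * poly (map_poly \<iota> f) (- s) =
      (\<iota> (coeff r 0))\<^sup>2 - s ^ 2 * (\<iota> (coeff r 1))\<^sup>2"
    using assms(2) by (simp add: val power2_eq_square algebra_simps)
  also have "\<dots> = \<iota> (sqrt_norm a f)"
    by (simp add: assms(2) sqrt_norm_def Let_def hom_distribs flip: g_def r_def)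
  finally show ?thesis .
qed

subsection \<open>Factors of a self-reciprocal polynomial\<close>

lemma frob_funpow_divide:
  "(frob ^^ i) (to_ac a / x) = to_ac a / (frob ^^ i) x"
  by (induction i) (simp_all add: frob.hom_div)

text \<open>Frobenius fixes \<open>a\<close>, so it commutes with the involution, which therefore
  maps orbits to orbits.\<close>

lemma orbit_to_ac_divide: "orbit (to_ac a / x) = (\<lambda>y. to_ac a / y) ` orbit x"
  by (auto simp: orbit_def frob_funpow_divide)

text \<open>
  For minimal \<open>m\<close> with \<open>frob^m x = a/x\<close>, the \<open>2m\<close> conjugates of \<open>x\<close> are the \<open>x\<^sub>i = frob^i x\<close> and
  the \<open>a/x\<^sub>i\<close> for \<open>i < m\<close>. Applying \<open>frob\<close> to \<open>\<Prod>i<m. x\<^sub>i - a/x\<^sub>i\<close> shifts the indices by one and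
  replaces the factor with index \<open>0\<close> by its negative.
\<close>

lemma self_conjugate_factor:
  fixes p :: "'a::finite_field poly"
  assumes p: "irreducible p" "lead_coeff p = 1"
    and root: "poly (map_poly to_ac p) x = 0" "poly (map_poly to_ac p) (to_ac a / x) = 0"
    and x: "x \<noteq> 0" "x ^ 2 \<noteq> to_ac a"
    and s: "s ^ 2 = to_ac a" "a \<noteq> 0"
  shows "\<exists>m D. degree p = 2 * m \<and> D \<noteq> 0 \<and> frob D = - D \<and>
    D ^ 2 = (- to_ac a) ^ m * (poly (map_poly to_ac p) s * poly (map_poly to_ac p) (- s))"
proof -
  define A where "A = to_ac a"
  define c where "c i = (frob ^^ i) x" for i
  have A: "A \<noteq> 0" using s by (simp add: A_def)
  have c_0: "c 0 = x" by (simp add: c_def)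
  have c_Suc: "frob (c i) = c (Suc i)" for i by (simp add: c_def)
  have c_nz: "c i \<noteq> 0" for i
    by (induction i) (simp_all add: c_def x)
  \<comment> \<open>Frobenius is injective and commutes with the involution, so relations between
    conjugates can be shifted back to index 0.\<close>
  have inj: "c (i + k) = c i \<longleftrightarrow> c k = x" for i k
    by (induction i) (simp_all add: c_def)
  have inj': "c (i + k) = A / c i \<longleftrightarrow> c k = A / x" for i k
  proof (induction i)
    case (Suc i)
    have "frob (A / c i) = A / c (Suc i)" by (simp add: A_def frob.hom_div c_Suc)
    then have "c (Suc i + k) = A / c (Suc i) \<longleftrightarrow> frob (c (i + k)) = frob (A / c i)"
      by (simp add: c_Suc)
    then show ?case using Suc by simp
  qed (simp add: c_def)
  have "\<exists>m. c m = A / x"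
    using irreducible_roots_eq_orbit[OF p root(1)] root(2) by (auto simp: orbit_def c_def A_def)
  define m where "m = (LEAST m. c m = A / x)"
  have m: "c m = A / x"
    unfolding m_def using \<open>\<exists>m. c m = A / x\<close> by (rule LeastI_ex)
  have m_min: "c i \<noteq> A / x" if "i < m" for i
    using not_less_Least[of i "\<lambda>m. c m = A / x"] that by (simp add: m_def)
  have c_m: "c (i + m) = A / c i" for i using inj' m by simp
  \<comment> \<open>A return to \<open>x\<close> after \<open>k\<close> steps would make
    \<open>m - k\<close> a smaller index with value \<open>A / x\<close>.\<close>
  have period: "c k \<noteq> x" if "0 < k" "k < m" for k
  proof
    assume "c k = x"
    then have "c ((m - k) + k) = c (m - k)" by (simp only: inj)
    then have "c (m - k) = A / x" using that m by simp
    then show False using m_min[of "m - k"] that by simp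
  qed
  have inj_c: "inj_on c {..<m}"
  proof (rule linorder_inj_onI)
    fix i j assume "i < j" "i \<in> {..<m}" "j \<in> {..<m}"
    then show "c i \<noteq> c j"
      using inj[of i "j - i"] period[of "j - i"] by auto
  qed auto
  have disj_le: "c j \<noteq> A / c i" if "i \<le> j" "j < m" for i j
    using inj'[of i "j - i"] m_min[of "j - i"] that by auto
  have disj: "c i \<noteq> A / c j" if "i < m" "j < m" for i j
  proof (cases "i \<le> j")
    case True
    show ?thesis
      using disj_le[OF True that(2)] c_nz[of i] c_nz[of j] by (auto simp: field_simps)
  qed (use disj_le that in auto)
  let ?C = "c ` {..<m}" and ?C' = "(\<lambda>i. A / c i) ` {..<m}"
  \<comment> \<open>The union is closed under Frobenius: the first half runs into
    \<open>A / x\<close>, the second half back into \<open>x\<close>.\<close>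
  have orbit_eq: "orbit x = ?C \<union> ?C'"
  proof
    have "c i \<in> orbit x" "A / c i \<in> orbit x" for i
      using c_m[of i] by (metis c_def funpow_frob_in_orbit)+
    then show "?C \<union> ?C' \<subseteq> orbit x" by auto
    have "c n \<in> ?C \<union> ?C'" for n
    proof (induction n)
      case 0
      show ?case
      \<comment> \<open>For \<open>m = 0\<close> the element \<open>x\<close> would be a fixed point
        of the involution, that is, a square root of \<open>a\<close>.\<close>
      proof (cases "m = 0")
        case True
        then have "x ^ 2 = A"
          using m x by (simp add: c_def field_simps power2_eq_square)
        then show ?thesis using x by (simp add: A_def)
      qed auto
    next
      case (Suc n)
      from Suc consider i where "i < m" "c n = c i" | i where "i < m" "c n = A / c i" by auto
      then show ?case
      proof cases
        case 1
        then have eq: "c (Suc n) = c (Suc i)" by (metis c_Suc)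
        show ?thesis
        proof (cases "Suc i < m")
          case False
          then have "Suc i = m" using 1 by simp
          then have "c (Suc i) = A / c 0" using m c_0 by simp
          moreover have "0 < m" using 1 by simp
          ultimately show ?thesis using eq by auto
        qed (use eq in auto)
      next
        case 2
        have "frob (A / c i) = A / c (Suc i)" by (simp add: A_def frob.hom_div c_Suc)
        with 2 have eq: "c (Suc n) = A / c (Suc i)" by (metis c_Suc)
        show ?thesis
        proof (cases "Suc i < m")
          case False
          then have "Suc i = m" using 2 by simp
          then have "c (Suc i) = A / c 0" using m c_0 by simp
          then have "c (Suc n) = c 0" using eq A by simp
          then show ?thesis using 2 by (metis UnI1 imageI lessThan_iff less_zeroE not_gr_zero)
        qed (use eq in auto)
      qed
    qed
    then show "orbit x \<subseteq> ?C \<union> ?C'" by (auto simp: orbit_def simp flip: c_def)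
  qed
  have inj_c': "inj_on (\<lambda>i. A / c i) {..<m}"
    using inj_c c_nz A by (auto simp: inj_on_def field_simps)
  have disjoint: "?C \<inter> ?C' = {}" using disj by auto
  have p_eq: "map_poly to_ac p = orbit_poly x"
    by (rule irreducible_eq_orbit_poly) (use p root in auto)
  have "degree p = card (orbit x)"
    using arg_cong[OF p_eq, of degree] by (simp add: degree_orbit_poly)
  also have "\<dots> = 2 * m"
    unfolding orbit_eq using disjoint
    by (subst card_Un_disjoint) (simp_all add: card_image inj_c inj_c')
  finally have deg: "degree p = 2 * m" .
  have val: "poly (map_poly to_ac p) t = (\<Prod>i<m. (t - c i) * (t - A / c i))" for t
    unfolding p_eq poly_orbit_poly orbit_eq using disjoint
    by (subst prod.union_disjoint) (simp_all add: prod.reindex inj_c inj_c' prod.distrib)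
  define E where "E = (\<Prod>i<m. c i - A / c i)"
  have E_nz: "E \<noteq> 0" using disj by (auto simp: E_def)
  have "frob E = (\<Prod>i<m. c (Suc i) - A / c (Suc i))"
    by (simp add: E_def frob.hom_prod frob.hom_minus frob.hom_div c_Suc A_def)
  then have "frob E * (c 0 - A / c 0) = E * (c m - A / c m)"
    using prod.lessThan_Suc_shift[of "\<lambda>i. c i - A / c i" m]
    by (simp add: E_def mult.commute)
  moreover have "c m - A / c m = - (c 0 - A / c 0)"
    using m A x by (simp add: c_def)
  moreover have "c 0 - A / c 0 \<noteq> 0"
    using x by (auto simp: c_def A_def field_simps power2_eq_square)
  ultimately have frob_E: "frob E = - E"
    by (metis minus_mult_commute mult_right_cancel)
  \<comment> \<open>Pairing \<open>s\<close> with \<open>- s\<close> gives y^2 - A and (A/y)^2 - A,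
    whose product is -A times a square.\<close>
  have factor: "(s - y) * (s - A / y) * ((- s - y) * (- s - A / y)) = - A * (y - A / y) ^ 2"
    if "y \<noteq> 0" for y
  proof -
    have "(s - y) * (- s - y) = y ^ 2 - A" "(s - A / y) * (- s - A / y) = (A / y) ^ 2 - A"
      using s(1) by (simp_all add: A_def power2_eq_square algebra_simps)
    then have "(s - y) * (s - A / y) * ((- s - y) * (- s - A / y)) = (y ^ 2 - A) * ((A / y) ^ 2 - A)"
      by (metis mult.assoc mult.left_commute)
    also have "\<dots> = - A * (y - A / y) ^ 2"
      using that by (simp add: field_simps power2_eq_square)
    finally show ?thesis .
  qed
  have "poly (map_poly to_ac p) s * poly (map_poly to_ac p) (- s) = (\<Prod>i<m. - A * (c i - A / c i) ^ 2)"
    by (simp add: val factor c_nz flip: prod.distrib)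
  also have "\<dots> = (- A) ^ m * E ^ 2"
    by (simp only: prod.distrib prod_constant prod_power_distrib E_def card_lessThan)
  \<comment> \<open>The extra \<open>(- A) ^ m\<close> completes the square; lying in the base
    field, it does not disturb the sign of \<open>E\<close> under Frobenius.\<close>
  finally have "((- A) ^ m * E) ^ 2 =
      (- A) ^ m * (poly (map_poly to_ac p) s * poly (map_poly to_ac p) (- s))"
    by (simp add: power2_eq_square algebra_simps)
  moreover have "frob ((- A) ^ m * E) = - ((- A) ^ m * E)"
    by (simp add: frob.hom_mult frob.hom_power frob.hom_uminus frob_E A_def)
  moreover have "(- A) ^ m * E \<noteq> 0" using A E_nz by simp
  ultimately show ?thesis using deg unfolding A_def by blast
qed

text \<open>The roots of \<open>p'\<close> are the a/y for the roots y of \<open>p\<close>, so at a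
  square root t of \<open>a\<close> the value of \<open>p'\<close> is t^d p(t)/p(0), with d the
  degree. Hence the product over both factors is (-a)^d times the square of p(s)p(-s)/p(0), which
  lies in the base field.\<close>

lemma conjugate_pair_factor:
  fixes p p' :: "'a::finite_field poly"
  assumes p: "irreducible p" "lead_coeff p = 1" "irreducible p'" "lead_coeff p' = 1"
    and root: "poly (map_poly to_ac p) x = 0" "poly (map_poly to_ac p') (to_ac a / x) = 0"
    and nz: "coeff p 0 \<noteq> 0" "poly (map_poly to_ac p) s \<noteq> 0" "poly (map_poly to_ac p) (- s) \<noteq> 0"
    and s: "s ^ 2 = to_ac a" "a \<noteq> 0"
  shows "\<exists>D. degree p' = degree p \<and> D \<noteq> 0 \<and> frob D = D \<and>
    D ^ 2 = (- to_ac a) ^ degree p * (poly (map_poly to_ac (p * p')) s * poly (map_poly to_ac (p * p')) (- s))"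
proof -
  define A where "A = to_ac a"
  define F F' where "F = poly (map_poly to_ac p)" and "F' = poly (map_poly to_ac p')"
  define d where "d = degree p"
  have A: "A \<noteq> 0" using s by (simp add: A_def)
  have p_eq: "map_poly to_ac p = orbit_poly x" "map_poly to_ac p' = orbit_poly (to_ac a / x)"
    using irreducible_eq_orbit_poly p root by blast+
  have F0: "F 0 = to_ac (coeff p 0)"
    by (simp add: F_def poly_0_coeff_0 coeff_map_poly)
  have "F 0 \<noteq> 0" using F0 nz by simp
  then have orbit_nz: "y \<noteq> 0" if "y \<in> orbit x" for y
    using that irreducible_roots_eq_orbit[OF p(1,2) root(1)] unfolding F_def by metis
  have inj: "inj_on (\<lambda>y. A / y) (orbit x)"
    using A orbit_nz by (auto simp: inj_on_def field_simps)
  have deg: "card (orbit x) = d"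
    using arg_cong[OF p_eq(1), of degree] by (simp add: degree_orbit_poly d_def)
  have "degree p' = card (orbit (to_ac a / x))"
    using arg_cong[OF p_eq(2), of degree] by (simp add: degree_orbit_poly)
  also have "\<dots> = d"
    using inj deg by (simp add: orbit_to_ac_divide card_image A_def)
  finally have deg': "degree p' = d" .
  have val: "F' t = t ^ d * F t / F 0" if "t ^ 2 = A" for t
  proof -
    have "F' t = (\<Prod>y\<in>orbit x. t - A / y)"
      using inj unfolding A_def by (simp add: F'_def p_eq poly_orbit_poly orbit_to_ac_divide prod.reindex)
    \<comment> \<open>Here \<open>A\<close> is rewritten as t^2.\<close>
    also have "\<dots> = (\<Prod>y\<in>orbit x. t * (t - y) / (0 - y))"
      by (rule prod.cong) (use orbit_nz in \<open>auto simp: field_simps power2_eq_square simp flip: that\<close>)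
    also have "\<dots> = t ^ d * F t / F 0"
      by (simp only: F_def p_eq poly_orbit_poly prod.distrib prod_dividef prod_constant deg)
    finally show ?thesis .
  qed
  define D where "D = (- A) ^ d * (F s * F (- s)) / F 0"
  have "F s * F (- s) = to_ac (sqrt_norm a p)"
    unfolding F_def by (rule hom_sqrt_norm[OF to_ac.field_hom_axioms s(1)])
  then have frob_D: "frob D = D"
    by (simp add: D_def F0 A_def frob.hom_mult frob.hom_power frob.hom_uminus frob.hom_div)
  have "D \<noteq> 0"
    using A nz \<open>F 0 \<noteq> 0\<close> by (simp add: D_def F_def)
  have "(- A) ^ d * ((F s * F' s) * (F (- s) * F' (- s))) =
      (- A) ^ d * (s ^ d * (- s) ^ d) * (F s * F (- s) / F 0) ^ 2"
    using s(1) by (simp add: val A_def power2_eq_square)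
  also have "s ^ d * (- s) ^ d = (- A) ^ d"
    using s(1) by (simp add: A_def power2_eq_square flip: power_mult_distrib)
  finally have "D ^ 2 = (- A) ^ d * ((F s * F' s) * (F (- s) * F' (- s)))"
    by (simp add: D_def power2_eq_square)
  then show ?thesis
    using frob_D \<open>D \<noteq> 0\<close> deg'
    by (intro exI[of _ D]) (simp add: to_ac_poly.hom_mult F_def F'_def A_def d_def)
qed

text \<open>One root sent to a root of \<open>p'\<close> settles all roots of \<open>p\<close>: they
  are Frobenius conjugates, and the involution respects conjugacy.\<close>

lemma conjugate_root_transfer:
  fixes p p' :: "'a::finite_field poly"
  assumes "irreducible p" "lead_coeff p = 1" "poly (map_poly to_ac p) x = 0"
    and "poly (map_poly to_ac p') (to_ac a / x) = 0" "poly (map_poly to_ac p) y = 0"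
  shows "poly (map_poly to_ac p') (to_ac a / y) = 0"
  using assms irreducible_roots_eq_orbit[OF assms(1-3)]
  by (intro poly_root_orbit[OF assms(4)]) (auto simp: orbit_to_ac_divide)

text \<open>
  \<open>D\<close> is a square root of an element of \<open>F\<^sub>q\<close>, and the sign with which \<open>frob\<close> acts on it
  records the parity of the number of factors: a self-conjugate factor contributes \<open>-1\<close>,
  a pair of conjugate factors contributes \<open>1\<close>.
\<close>

lemma exists_sqrt_with_frob_sign:
  fixes P :: "'a::finite_field poly set"
  assumes "finite P" "\<forall>p\<in>P. lead_coeff p = 1 \<and> irreducible p"
    and "\<forall>p\<in>P. \<forall>x. poly (map_poly to_ac p) x = 0 \<longrightarrow>
      x \<noteq> 0 \<and> x ^ 2 \<noteq> to_ac a \<and> (\<exists>p'\<in>P. poly (map_poly to_ac p') (to_ac a / x) = 0)"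
    and s: "s ^ 2 = to_ac a" "a \<noteq> 0"
  shows "\<exists>n D. degree (\<Prod>P) = 2 * n \<and> D \<noteq> 0 \<and> frob D = (- 1) ^ card P * D \<and>
    D ^ 2 = (- to_ac a) ^ n * (poly (map_poly to_ac (\<Prod>P)) s * poly (map_poly to_ac (\<Prod>P)) (- s))"
  using assms(1-3)
proof (induction P rule: finite_psubset_induct)
  case (psubset P)
  note irr = psubset.prems(1) and closed = psubset.prems(2)
  show ?case
  proof (cases "P = {}")
    case True
    then show ?thesis by (intro exI[of _ 0] exI[of _ 1]) simp
  next
    case False
    then obtain p where pP: "p \<in> P" by blast
    then obtain x where x: "poly (map_poly to_ac p) x = 0"
      using irr irreducible_root_exists by blast
    then have x_nz: "x \<noteq> 0" "x ^ 2 \<noteq> to_ac a" using closed pP by blast+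
    obtain p' where p'P: "p' \<in> P" and x': "poly (map_poly to_ac p') (to_ac a / x) = 0"
      using closed pP x by blast
    have p: "irreducible p" "lead_coeff p = 1" "irreducible p'" "lead_coeff p' = 1"
      using irr pP p'P by auto
    have double: "to_ac a / (to_ac a / y) = y" for y using s(2) by simp
    have x'': "poly (map_poly to_ac p) (to_ac a / (to_ac a / x)) = 0"
      using x by (simp only: double)
    \<comment> \<open>The factor \<open>p\<close> and its partner, possibly equal, are removed
      together so that the rest stays closed under the involution.\<close>
    define Q where "Q = P - {p, p'}"
    have "\<exists>q'\<in>Q. poly (map_poly to_ac q') (to_ac a / y) = 0"
      if q: "q \<in> Q" and y: "poly (map_poly to_ac q) y = 0" for q y
    proof -
      obtain q' where q': "q' \<in> P" "poly (map_poly to_ac q') (to_ac a / y) = 0"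
        using q y closed by (auto simp: Q_def)
      have qirr: "irreducible q" "lead_coeff q = 1" using q irr by (auto simp: Q_def)
      \<comment> \<open>Otherwise applying the involution again would make \<open>y\<close> a common
        root of \<open>q\<close> and \<open>p'\<close>.\<close>
      have "q' \<noteq> p"
      proof
        assume "q' = p"
        then have "poly (map_poly to_ac p') y = 0"
          using conjugate_root_transfer[OF p(1,2) x x', of "to_ac a / y"] q'(2)
          by (simp only: double)
        then show False
          using irreducible_common_root_eq[OF qirr y p(3,4)] q by (simp add: Q_def)
      qed
      moreover have "q' \<noteq> p'"
      proof
        assume "q' = p'"
        then have "poly (map_poly to_ac p) y = 0"
          using conjugate_root_transfer[OF p(3,4) x' x'', of "to_ac a / y"] q'(2)
          by (simp only: double)
        then show False
          using irreducible_common_root_eq[OF qirr y p(1,2)] q by (simp add: Q_def)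
      qed
      ultimately show ?thesis using q' by (auto simp: Q_def)
    qed
    then have "\<forall>q\<in>Q. \<forall>y. poly (map_poly to_ac q) y = 0 \<longrightarrow>
        y \<noteq> 0 \<and> y ^ 2 \<noteq> to_ac a \<and> (\<exists>q'\<in>Q. poly (map_poly to_ac q') (to_ac a / y) = 0)"
      using closed unfolding Q_def by blast
    moreover have "Q \<subset> P" using pP by (auto simp: Q_def)
    moreover have "\<forall>q\<in>Q. lead_coeff q = 1 \<and> irreducible q" using irr by (simp add: Q_def)
    ultimately obtain n D where Q: "degree (\<Prod>Q) = 2 * n" "D \<noteq> 0" "frob D = (- 1) ^ card Q * D"
      "D ^ 2 = (- to_ac a) ^ n * (poly (map_poly to_ac (\<Prod>Q)) s * poly (map_poly to_ac (\<Prod>Q)) (- s))"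
      using psubset.IH[of Q] by blast
    have finQ: "finite Q" and notin: "p \<notin> Q" "p' \<notin> Q"
      using psubset.hyps(1) by (auto simp: Q_def)
    have nz: "p \<noteq> 0" "p' \<noteq> 0" "\<Prod>Q \<noteq> 0"
      using p irr finQ by (auto simp: Q_def)
    show ?thesis
    proof (cases "p' = p")
      case True
      have P: "P = insert p Q" using pP True by (auto simp: Q_def)
      obtain m E where E: "degree p = 2 * m" "E \<noteq> 0" "frob E = - E"
        "E ^ 2 = (- to_ac a) ^ m * (poly (map_poly to_ac p) s * poly (map_poly to_ac p) (- s))"
        using self_conjugate_factor[OF p(1,2) x _ x_nz s] x' True by blast
      have "degree (\<Prod>P) = 2 * (m + n)"
        using P finQ notin nz E Q by (simp add: degree_mult_eq)
      moreover have "frob (E * D) = (- 1) ^ card P * (E * D)"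
        using P finQ notin E Q by (simp add: frob.hom_mult)
      moreover have "(E * D) ^ 2 = (- to_ac a) ^ (m + n) *
          (poly (map_poly to_ac (\<Prod>P)) s * poly (map_poly to_ac (\<Prod>P)) (- s))"
        unfolding power_mult_distrib E(4) Q(4)
        using P finQ notin by (simp add: to_ac_poly.hom_mult power_add ac_simps)
      ultimately show ?thesis using E(2) Q(2)
        by (intro exI[of _ "m + n"] exI[of _ "E * D"]) simp
    next
      case False
      have P: "P = insert p (insert p' Q)" using pP p'P by (auto simp: Q_def)
      have nonroot: "poly (map_poly to_ac p) t \<noteq> 0" if "t ^ 2 = to_ac a" for t
        using closed pP that by blast
      have "poly (map_poly to_ac p) 0 \<noteq> 0" using closed pP by blast
      then have "coeff p 0 \<noteq> 0"
        by (simp add: poly_0_coeff_0 coeff_map_poly del: to_ac.poly_map_poly_0)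
      moreover have "(- s) ^ 2 = to_ac a" using s(1) by simp
      ultimately obtain E where E: "degree p' = degree p" "E \<noteq> 0" "frob E = E"
        "E ^ 2 = (- to_ac a) ^ degree p *
          (poly (map_poly to_ac (p * p')) s * poly (map_poly to_ac (p * p')) (- s))"
        using conjugate_pair_factor[OF p x x' _ _ _ s] nonroot s(1) by blast
      have "degree (\<Prod>P) = 2 * (degree p + n)"
        using P finQ notin nz False E Q by (simp add: degree_mult_eq)
      moreover have "frob (E * D) = (- 1) ^ card P * (E * D)"
        using P finQ notin False E Q by (simp add: frob.hom_mult)
      moreover have "(E * D) ^ 2 = (- to_ac a) ^ (degree p + n) *
          (poly (map_poly to_ac (\<Prod>P)) s * poly (map_poly to_ac (\<Prod>P)) (- s))"
        unfolding power_mult_distrib E(4) Q(4)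
        using P finQ notin False by (simp add: to_ac_poly.hom_mult power_add ac_simps)
      ultimately show ?thesis using E(2) Q(2)
        by (intro exI[of _ "degree p + n"] exI[of _ "E * D"]) simp
    qed
  qed
qed

subsection \<open>Roots of self-reciprocal polynomials\<close>

text \<open>The characteristic divides the cardinality. Oddness enters the main argument only here,
  to cancel 2 and to separate \<open>D\<close> from \<open>- D\<close>.\<close>

lemma CARD_odd_two_neq_0:
  assumes "odd CARD('a::finite_field)"
  shows "(2 :: 'a) \<noteq> 0"
proof
  assume "(2 :: 'a) = 0"
  then have "CHAR('a) dvd 2"
    by (metis of_nat_eq_0_iff_char_dvd of_nat_numeral)
  then have "CHAR('a) = 2"
    using prime_CHAR_semidom[where 'a = 'a] primes_dvd_imp_eq two_is_prime_nat CHAR_pos by blast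
  then show False
    using assms CHAR_dvd_CARD[where 'a = 'a] by simp
qed

lemma coeff_a_reciprocal:
  assumes "i \<le> degree f"
  shows "coeff (a_reciprocal a f) (degree f - i) = coeff f i * a ^ i / coeff f 0"
proof -
  have "(\<Sum>j\<le>degree f. coeff (monom (coeff f j * a ^ j) (degree f - j)) (degree f - i)) =
      (\<Sum>j\<in>{i}. coeff f j * a ^ j)"
    by (rule sum.mono_neutral_cong_right) (use assms in auto)
  then show ?thesis
    by (simp add: a_reciprocal_def coeff_sum)
qed

text \<open>The constant term excludes the root 0, and self-reciprocity persists under the
  embedding, so it can be evaluated at \<open>x\<close>.\<close>

lemma self_reciprocal_root:
  assumes "self_reciprocal a f" "field_hom \<iota>" "poly (map_poly \<iota> f) x = 0"
  shows "x \<noteq> 0" "poly (map_poly \<iota> f) (\<iota> a / x) = 0"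
proof -
  interpret field_hom \<iota> by fact
  interpret poly: map_poly_inj_idom_hom \<iota> ..
  have f0: "coeff f 0 \<noteq> 0" and rec: "a_reciprocal a f = f"
    using assms(1) by (auto simp: self_reciprocal_def)
  have "poly (map_poly \<iota> f) 0 \<noteq> 0"
    using f0 by (simp add: poly_0_coeff_0)
  then show "x \<noteq> 0" using assms(3) by metis
  have deg: "degree (map_poly \<iota> f) = degree f" by (simp add: degree_map_poly)
  have "map_poly \<iota> (a_reciprocal a f) = a_reciprocal (\<iota> a) (map_poly \<iota> f)"
    by (simp add: a_reciprocal_def hom_distribs deg map_poly_monom)
  then have "poly (a_reciprocal (\<iota> a) (map_poly \<iota> f)) x = 0"
    using assms(3) rec by simp
  then show "poly (map_poly \<iota> f) (\<iota> a / x) = 0"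
    using \<open>x \<noteq> 0\<close> f0 by (simp add: poly_a_reciprocal poly_0_coeff_0)
qed

text \<open>
  Differentiating \<open>a^n f(x) = x^(2n) f(a/x)\<close> at a square root \<open>s\<close> of \<open>a\<close>.
\<close>

lemma self_reciprocal_pderiv_sqrt:
  fixes f :: "'a::field poly"
  assumes rec: "a_reciprocal a f = f" and deg: "degree f = 2 * n"
    and f0: "coeff f 0 = a ^ n" and s: "s ^ 2 = \<iota> a" "field_hom \<iota>" "a \<noteq> 0"
  shows "2 * (s * poly (pderiv (map_poly \<iota> f)) s) = of_nat (2 * n) * poly (map_poly \<iota> f) s"
proof -
  interpret field_hom \<iota> by fact
  define b where "b i = \<iota> (coeff f i)" for i
  define A where "A = \<iota> a"
  have A: "A \<noteq> 0" using s by (simp add: A_def)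
  have degF: "degree (map_poly \<iota> f) = 2 * n" by (simp add: degree_map_poly deg)
  have sym: "A ^ n * b (2 * n - i) = b i * A ^ i" if "i \<le> 2 * n" for i
  proof -
    have "coeff f (2 * n - i) = coeff f i * a ^ i / a ^ n"
      using coeff_a_reciprocal[of i f a] that by (simp add: rec deg f0)
    then show ?thesis
      using A by (simp add: b_def A_def hom_distribs)
  qed
  have F: "poly (map_poly \<iota> f) s = (\<Sum>i\<le>2 * n. b i * s ^ i)"
    by (simp add: poly_altdef deg b_def)
  have F': "s * poly (pderiv (map_poly \<iota> f)) s = (\<Sum>i\<le>2 * n. of_nat i * b i * s ^ i)"
  proof -
    \<comment> \<open>This is X times the derivative, whose coefficients are those of
      \<open>f\<close> weighted by their index.\<close>
    let ?G = "pCons 0 (pderiv (map_poly \<iota> f))"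
    have coeff: "coeff ?G i = of_nat i * b i" for i
      by (simp add: coeff_pCons coeff_pderiv b_def split: nat.split)
    have "degree ?G \<le> 2 * n"
      by (rule degree_le) (use degF in \<open>auto simp: coeff b_def coeff_eq_0 deg\<close>)
    then have "poly ?G s = (\<Sum>i\<le>2 * n. coeff ?G i * s ^ i)"
      unfolding poly_altdef by (intro sum.mono_neutral_left) (auto simp: coeff_eq_0)
    then show ?thesis by (simp only: coeff) (simp add: pderiv_pCons)
  qed
  \<comment> \<open>Reversing the indices and using the symmetry of the coefficients together with
    s^2 = A turns the weight i into 2n - i.\<close>
  have "A ^ n * (\<Sum>i\<le>2 * n. of_nat i * b i * s ^ i) =
      A ^ n * (\<Sum>i\<le>2 * n. of_nat (2 * n - i) * b (2 * n - i) * s ^ (2 * n - i))"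
    by (rule arg_cong[OF sum.reindex_bij_witness[of _ "\<lambda>i. 2 * n - i" "\<lambda>i. 2 * n - i"]]) auto
  also have "\<dots> = (\<Sum>i\<le>2 * n. of_nat (2 * n - i) * (A ^ n * b (2 * n - i)) * s ^ (2 * n - i))"
    by (simp add: sum_distrib_left ac_simps)
  also have "\<dots> = (\<Sum>i\<le>2 * n. of_nat (2 * n - i) * b i * (A ^ i * s ^ (2 * n - i)))"
    by (rule sum.cong) (simp_all add: sym)
  also have "\<dots> = (\<Sum>i\<le>2 * n. of_nat (2 * n - i) * b i * (A ^ n * s ^ i))"
  proof (rule sum.cong)
    fix i assume "i \<in> {..2 * n}"
    then have i: "2 * i + (2 * n - i) = 2 * n + i" by simp
    have "A ^ i * s ^ (2 * n - i) = s ^ (2 * i + (2 * n - i))"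
      by (simp only: A_def power_add power_mult s(1))
    also have "\<dots> = A ^ n * s ^ i"
      by (simp only: i A_def power_add power_mult s(1))
    finally show "of_nat (2 * n - i) * b i * (A ^ i * s ^ (2 * n - i)) =
        of_nat (2 * n - i) * b i * (A ^ n * s ^ i)"
      by simp
  qed simp
  also have "\<dots> = A ^ n * (\<Sum>i\<le>2 * n. of_nat (2 * n - i) * b i * s ^ i)"
    by (simp add: sum_distrib_left ac_simps)
  finally have "(\<Sum>i\<le>2 * n. of_nat i * b i * s ^ i) = (\<Sum>i\<le>2 * n. of_nat (2 * n - i) * b i * s ^ i)"
    using A by simp
  \<comment> \<open>Adding the two forms of the sum gives every term the constant weight 2n.\<close>
  then have "2 * (\<Sum>i\<le>2 * n. of_nat i * b i * s ^ i) =
      (\<Sum>i\<le>2 * n. of_nat i * b i * s ^ i + of_nat (2 * n - i) * b i * s ^ i)"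
    by (simp add: sum.distrib)
  also have "\<dots> = (\<Sum>i\<le>2 * n. of_nat (2 * n) * (b i * s ^ i))"
  proof (rule sum.cong)
    fix i assume "i \<in> {..2 * n}"
    then have "of_nat (2 * n) = (of_nat i + of_nat (2 * n - i) :: 'b)"
      by (simp flip: of_nat_add)
    then show "of_nat i * b i * s ^ i + of_nat (2 * n - i) * b i * s ^ i = of_nat (2 * n) * (b i * s ^ i)"
      by (simp only: distrib_right mult.assoc)
  qed simp
  also have "\<dots> = of_nat (2 * n) * (\<Sum>i\<le>2 * n. b i * s ^ i)"
    by (simp add: sum_distrib_left)
  finally show ?thesis by (simp only: F F')
qed

text \<open>Every root is simple: it occurs once in the orbit polynomial of its own factor, and no
  other factor shares it.\<close>

lemma pderiv_distinct_irreducibles_neq_0: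
  fixes P :: "'a::finite_field poly set"
  assumes "finite P" "\<forall>p\<in>P. lead_coeff p = 1 \<and> irreducible p"
    and root: "poly (map_poly to_ac (\<Prod>P)) x = 0"
  shows "poly (pderiv (map_poly to_ac (\<Prod>P))) x \<noteq> 0"
proof -
  have prod: "map_poly to_ac (\<Prod>P) = (\<Prod>p\<in>P. map_poly to_ac p)"
    by (simp add: to_ac_poly.hom_prod)
  then obtain p where p: "p \<in> P" "poly (map_poly to_ac p) x = 0"
    using root assms(1) by (auto simp: poly_prod)
  define H where "H = (\<Prod>y\<in>orbit x - {x}. [:- y, 1:]) * (\<Prod>q\<in>P - {p}. map_poly to_ac q)"
  have "map_poly to_ac p = orbit_poly x"
    by (rule irreducible_eq_orbit_poly) (use p assms in auto)
  also have "\<dots> = [:- x, 1:] * (\<Prod>y\<in>orbit x - {x}. [:- y, 1:])"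
    unfolding orbit_poly_def by (rule prod.remove) auto
  finally have F: "map_poly to_ac (\<Prod>P) = [:- x, 1:] * H"
    using prod.remove[OF assms(1) p(1), of "map_poly to_ac"]
    by (simp only: prod H_def mult.assoc)
  have "poly (map_poly to_ac q) x \<noteq> 0" if "q \<in> P - {p}" for q
    using irreducible_common_root_eq[of q x p] that p assms(2) by blast
  then have "poly H x \<noteq> 0"
    using assms(1) by (auto simp: H_def poly_prod)
  moreover have "poly (pderiv (map_poly to_ac (\<Prod>P))) x = poly H x"
    unfolding F by (simp only: pderiv_mult) (simp add: pderiv_pCons)
  ultimately show ?thesis by simp
qed

section \<open>Parity of the number of factors and squareness in the base field\<close>

theorem theorem5:
  fixes a :: "'a::finite_field" and f :: "'a poly" and P :: "'a poly set"
    and n r :: nat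
    and \<iota> :: "'a \<Rightarrow> 'b::field" and s :: 'b
  assumes "odd CARD('a)"
    and "a \<noteq> 0" and "n \<ge> 1"
    and "nontrivial_self_reciprocal a f" and "degree f = 2 * n"
    and "finite P" and "card P = r"
    and "\<forall>p\<in>P. lead_coeff p = 1 \<and> irreducible p"
    and "f = (\<Prod>p\<in>P. p)"
    and "field_hom \<iota>" and "s ^ 2 = \<iota> a"
  shows "even r \<longleftrightarrow>
    (\<exists>c::'a. is_square c \<and>
       \<iota> c = \<iota> ((- 1) ^ n * a powi (int n * (int n - 2)))
             * poly (map_poly \<iota> f) s * poly (map_poly \<iota> f) (- s))"
proof -
  interpret \<iota>: field_hom \<iota> by fact
  let ?F = "map_poly to_ac f"
  have rec: "self_reciprocal a f" and f0: "coeff f 0 = a ^ n"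
    using assms(4,5) by (auto simp: nontrivial_self_reciprocal_def)
  have f_eq: "f = \<Prod>P" using assms(9) by simp
  have two: "(2 :: 'a alg_closure) \<noteq> 0"
    using CARD_odd_two_neq_0[OF assms(1)] by (metis to_ac_eq_0_iff to_ac_numeral)
  \<comment> \<open>The Frobenius argument uses a square root in the algebraic closure;
    \<open>sqrt_norm\<close> later links it to \<open>s\<close> in the given extension.\<close>
  obtain t where t: "t ^ 2 = to_ac a"
    using nth_root_exists[of 2 "to_ac a"] by auto
  \<comment> \<open>By the derivative identity a root with this property would be a double
    root.\<close>
  have nonroot: "x ^ 2 \<noteq> to_ac a" if "poly ?F x = 0" for x
  proof
    assume x: "x ^ 2 = to_ac a"
    then have "2 * (x * poly (pderiv ?F) x) = 0"
      using self_reciprocal_pderiv_sqrt[OF _ assms(5) f0 x to_ac.field_hom_axioms assms(2)]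
        rec that by (simp add: self_reciprocal_def)
    then have "poly (pderiv ?F) x = 0"
      using two self_reciprocal_root(1)[OF rec to_ac.field_hom_axioms that] by simp
    then show False
      using pderiv_distinct_irreducibles_neq_0[OF assms(6,8)] that f_eq by blast
  qed
  have root_iff: "poly ?F x = 0 \<longleftrightarrow> (\<exists>p\<in>P. poly (map_poly to_ac p) x = 0)" for x
    using assms(6) by (simp add: f_eq to_ac_poly.hom_prod poly_prod)
  have closed: "\<forall>p\<in>P. \<forall>x. poly (map_poly to_ac p) x = 0 \<longrightarrow>
      x \<noteq> 0 \<and> x ^ 2 \<noteq> to_ac a \<and> (\<exists>p'\<in>P. poly (map_poly to_ac p') (to_ac a / x) = 0)"
    using root_iff nonroot self_reciprocal_root[OF rec to_ac.field_hom_axioms] by blast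
  obtain D where D: "D \<noteq> 0" "frob D = (- 1) ^ r * D"
    "D ^ 2 = (- to_ac a) ^ n * (poly ?F t * poly ?F (- t))"
    using exists_sqrt_with_frob_sign[OF assms(6,8) closed t assms(2)] assms(5,7)
    by (auto simp flip: f_eq)
  define h where "h = (- a) ^ n * sqrt_norm a f"
  have D2: "D ^ 2 = to_ac h"
    unfolding D(3) hom_sqrt_norm[OF to_ac.field_hom_axioms t] by (simp add: h_def)
  \<comment> \<open>The square roots of \<open>h\<close> in the closure are \<open>D\<close> and
    \<open>- D\<close>, so \<open>h\<close> is a square in the base field exactly when Frobenius
    fixes \<open>D\<close>.\<close>
  have square_iff: "is_square h \<longleftrightarrow> even r"
  proof
    assume "is_square h"
    then obtain c where "D ^ 2 = (to_ac c) ^ 2" using D2 by (auto elim!: is_nth_powerE)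
    then have "frob D = D" by (auto simp: power2_eq_iff frob.hom_uminus)
    show "even r"
    proof (rule ccontr)
      assume "odd r"
      then have "2 * D = 0" using \<open>frob D = D\<close> D(2) by simp
      then show False using two D(1) by simp
    qed
  next
    assume "even r"
    then obtain c where "D = to_ac c" using D(2) by (auto simp: frob_eq_self_iff)
    then have "h = c ^ 2" using D2 by (simp flip: to_ac_power)
    then show "is_square h" ..
  qed
  define e where "e = (- 1) ^ n * a powi (int n * (int n - 2))"
  \<comment> \<open>The exponents n(n-2) and n differ by the even number n(n-3), negative for n = 1
    and n = 2, so \<open>k\<close> is an integer and \<open>u\<close> an integer power.\<close>
  have "even (int n * (int n - 3))" by simp
  then obtain k where "int n * (int n - 3) = 2 * k" by blast
  then have k: "int n * (int n - 2) = int n + 2 * k" by (simp add: algebra_simps)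
  define u where "u = a powi k"
  have "a powi (int n * (int n - 2)) = a ^ n * u ^ 2"
    by (simp only: u_def k mult_2 power2_eq_square power_int_add power_int_of_nat assms(2) simp_thms)
  then have "e = (- a) ^ n * u ^ 2" by (simp add: e_def power_minus[of a])
  then have e: "e * sqrt_norm a f = h * u ^ 2" by (simp add: h_def)
  have "u \<noteq> 0" using assms(2) by (simp add: u_def)
  have "is_square (h * u ^ 2) \<longleftrightarrow> is_square h"
  proof
    assume "is_square (h * u ^ 2)"
    then obtain y where "h * u ^ 2 = y ^ 2" by (auto elim: is_nth_powerE)
    then have "h = (y / u) ^ 2" using \<open>u \<noteq> 0\<close> by (simp add: field_simps)
    then show "is_square h" ..
  qed (auto elim!: is_nth_powerE simp flip: power_mult_distrib)
  moreover have "\<iota> e * poly (map_poly \<iota> f) s * poly (map_poly \<iota> f) (- s) = \<iota> (h * u ^ 2)"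
    using hom_sqrt_norm[OF assms(10,11), of f] by (simp add: mult.assoc \<iota>.hom_mult flip: e)
  ultimately show ?thesis
    using square_iff by (simp flip: e_def)
qed

end
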